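(* Let $\alpha,\beta,\gamma>0$ be real numbers such that $\alpha\gamma\ge 1$, $\alpha^{2}\gamma\ge\beta$, $[\Gamma(\beta)]^{\gamma}=1$, $\log(2)-\alpha\gamma\log(\alpha+\beta)+\alpha\gamma\delta<0$ (where $\delta$ is the Euler–Mascheroni constant), and $[\Gamma(\alpha+\beta)]^{\gamma}>e$. Then the Le Roy type Mittag-Leffler function $$F_{\alpha,\beta}^{\gamma}(z)=\sum_{n=0}^{\infty}\frac{z^{n}}{[\Gamma(\alpha n+\beta)]^{\gamma}}$$ is subordinate to the exponential function $e^{z}$ on the open unit disk $\mathcal{D}=\{z\in\mathbb{C}:|z|<1\}$.
   Context: $\Gamma$ is the Euler gamma function. Subordination: an analytic function $f$ on $\mathcal{D}$ is subordinate to an analytic univalent function $g$ on $\mathcal{D}$ if there exists a Schwarz function $w$, i.e. an analytic function on $\mathcal{D}$ with $w(0)=0$ and $|w(z)|\le|z|<1$, such that $f(z)=g(w(z))$ for all $z\in\mathcal{D}$ (equivalently, $f(0)=g(0)$ and $f(\mathcal{D})\subset g(\mathcal{D})$). *)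

theory Defs
  imports "HOL-Complex_Analysis.Complex_Analysis"
begin

abbreviation unit_disk :: "complex set" where
  "unit_disk \<equiv> ball 0 1"

definition schwarz_function :: "(complex \<Rightarrow> complex) \<Rightarrow> bool" where
  "schwarz_function w \<longleftrightarrow>
     w analytic_on unit_disk \<and> w 0 = 0 \<and> (\<forall>z\<in>unit_disk. cmod (w z) \<le> cmod z)"

text \<open>Subordination is a relation between an analytic function and an analytic univalent
  function; these requirements are part of the predicate, so that asserting subordination
  asserts them as well.\<close>

definition subordinate :: "(complex \<Rightarrow> complex) \<Rightarrow> (complex \<Rightarrow> complex) \<Rightarrow> bool" where
  "subordinate f g \<longleftrightarrow>
     f analytic_on unit_disk \<and> g analytic_on unit_disk \<and> inj_on g unit_disk \<and>
     (\<exists>w. schwarz_function w \<and> (\<forall>z\<in>unit_disk. f z = g (w z)))"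

text \<open>The arguments of the Gamma function are positive reals for positive parameters, so its
  values are positive and the real power is the ordinary one.\<close>

definition le_roy_mittag_leffler :: "real \<Rightarrow> real \<Rightarrow> real \<Rightarrow> complex \<Rightarrow> complex" where
  "le_roy_mittag_leffler \<alpha> \<beta> \<gamma> z =
     (\<Sum>n. z ^ n / complex_of_real (Gamma (\<alpha> * real n + \<beta>) powr \<gamma>))"

end

theory Submission
  imports Defs
begin

text \<open>
  The exponential maps the unit disk onto a region containing the disk of radius
  \<open>1 - 1/e\<close> about \<open>1\<close>: if \<open>|u| < 1 - 1/e\<close>, comparing Taylor coefficients gives
  \<open>|Ln (1 + u)| \<le> - ln (1 - |u|) < 1\<close>. So it is enough to keep the values of the Le Roy type
  function \<open>F\<close> that close to \<open>1\<close>; the principal logarithm of \<open>F\<close> then maps the unit disk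
  into itself and, by Schwarz's lemma, is the required Schwarz function.

  The coefficients \<open>a\<^sub>n = 1 / \<Gamma>(\<alpha> n + \<beta>)\<^sup>\<gamma>\<close> are sampled along an arithmetic progression, so
  the log-convexity of \<open>\<Gamma>\<close> makes them log-concave: the quotients \<open>a\<^sub>n\<^sub>+\<^sub>1 / a\<^sub>n\<close> decrease. Since
  \<open>a\<^sub>0 = 1\<close>, every quotient is at most \<open>q = a\<^sub>1\<close>, whence \<open>a\<^sub>n \<le> q\<^sup>n\<close>. With \<open>q < 1/e\<close> the
  geometric series yields \<open>|F(z) - 1| \<le> q / (1 - q) < 1 / (e - 1)\<close>, and
  \<open>1 / (e - 1) \<le> 1 - 1/e\<close> because \<open>e\<^sup>2 - 3 e + 1 \<ge> 0\<close>.
\<close>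

text \<open>The Taylor coefficients of \<open>- ln (1 - x)\<close> are the absolute values of those of
  \<open>Ln (1 + u)\<close>, so the triangle inequality applies term by term.\<close>

lemma norm_Ln_one_plus_le:
  fixes u :: complex
  assumes "cmod u < 1"
  shows "cmod (Ln (1 + u)) \<le> - ln (1 - cmod u)"
proof -
  have L: "(\<lambda>n. - ((- u) ^ n) / of_nat n) sums Ln (1 + u)"
    using assms by (rule Ln_series')
  have "(\<lambda>n. - ((- (- cmod u)) ^ n) / of_nat n) sums ln (1 + - cmod u)"
    using assms by (intro ln_series') simp
  then have R: "(\<lambda>n. cmod u ^ n / of_nat n) sums - ln (1 - cmod u)"
    using sums_minus by fastforce
  have "cmod (- ((- u) ^ n) / of_nat n) = cmod u ^ n / of_nat n" for n
    by (simp add: norm_divide norm_power)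
  then show ?thesis
    using norm_sums_le[OF L R] by simp
qed

lemma subordinate_exp_if_near_one:
  assumes hol: "f holomorphic_on unit_disk" and "f 0 = 1"
    and near: "\<And>z. z \<in> unit_disk \<Longrightarrow> cmod (f z - 1) < 1 - exp (- 1)"
  shows "subordinate f exp"
proof -
  let ?w = "\<lambda>z. Ln (f z)"
  have less_1: "cmod (f z - 1) < 1" if "z \<in> unit_disk" for z
    using near[OF that] exp_gt_zero[of "- 1 :: real"] by linarith
  have right_half_plane: "Re (f z) > 0" if "z \<in> unit_disk" for z
    using less_1[OF that] abs_Re_le_cmod[of "f z - 1"] by simp
  have hol_w: "?w holomorphic_on unit_disk"
    using hol right_half_plane
    by (intro holomorphic_on_Ln') (auto simp: complex_nonpos_Reals_iff dest: leD)
  have w_less_1: "cmod (?w z) < 1" if "z \<in> unit_disk" for z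
  proof -
    have "cmod (?w z) \<le> - ln (1 - cmod (f z - 1))"
      using norm_Ln_one_plus_le[OF less_1[OF that]] by simp
    also have "\<dots> < - ln (exp (- 1))"
      using near[OF that] less_1[OF that] by (subst neg_less_iff_less, subst ln_less_cancel_iff) auto
    finally show ?thesis by simp
  qed
  have "cmod (?w z) \<le> cmod z" if "z \<in> unit_disk" for z
    using hol_w w_less_1 that \<open>f 0 = 1\<close> by (intro Schwarz_Lemma(1)) auto
  then have "schwarz_function ?w"
    using hol_w \<open>f 0 = 1\<close> by (simp add: schwarz_function_def analytic_on_open)
  moreover have "f z = exp (?w z)" if "z \<in> unit_disk" for z
    using right_half_plane[OF that] by (subst exp_Ln) auto
  moreover have "inj_on exp unit_disk"
    using pi_gt3 by (intro inj_on_subset[OF inj_on_exp_pi[of 0]] subset_ball) simp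
  moreover have "exp analytic_on unit_disk"
    by (simp add: analytic_on_open holomorphic_on_exp)
  moreover have "f analytic_on unit_disk"
    using hol by (simp add: analytic_on_open)
  ultimately show ?thesis
    unfolding subordinate_def by blast
qed

lemma power_series_subordinate_exp:
  fixes a :: "nat \<Rightarrow> complex" and q :: real
  assumes "a 0 = 1" and "q < exp (- 1)"
    and dom: "\<And>n. cmod (a n) \<le> q ^ n"
  shows "subordinate (\<lambda>z. \<Sum>n. a n * z ^ n) exp"
proof (rule subordinate_exp_if_near_one)
  let ?F = "\<lambda>z. \<Sum>n. a n * z ^ n"
  have "0 \<le> q"
    using order_trans[OF norm_ge_zero dom[of 1]] by simp
  have "q < 1"
    using \<open>q < exp (- 1)\<close> exp_less_one_iff[of "- 1 :: real"] by linarith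
  have term_le: "cmod (a n * z ^ n) \<le> q ^ n" if "z \<in> unit_disk" for n z
  proof -
    have "cmod (a n) * cmod z ^ n \<le> q ^ n * 1"
      using dom that \<open>0 \<le> q\<close> by (intro mult_mono) (auto simp: power_le_one)
    then show ?thesis by (simp add: norm_mult norm_power)
  qed
  have summable: "summable (\<lambda>n. a n * z ^ n)" if "z \<in> unit_disk" for z
    using term_le[OF that] \<open>0 \<le> q\<close> \<open>q < 1\<close>
    by (intro summable_comparison_test'[OF summable_geometric[of q]]) auto
  show "?F holomorphic_on unit_disk"
    using summable by (intro power_series_holomorphic[of 0 1 a]) (auto simp: summable_sums)
  show "?F 0 = 1"
    using \<open>a 0 = 1\<close> by simp
  show "cmod (?F z - 1) < 1 - exp (- 1)" if z: "z \<in> unit_disk" for z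
  proof -
    have tail: "(\<lambda>n. a (Suc n) * z ^ Suc n) sums (?F z - 1)"
      using summable_sums[OF summable[OF z]] \<open>a 0 = 1\<close> by (subst sums_Suc_iff) simp
    have "(\<lambda>n. q * q ^ n) sums (q * (1 / (1 - q)))"
      using \<open>0 \<le> q\<close> \<open>q < 1\<close> by (intro sums_mult geometric_sums) simp
    then have geom: "(\<lambda>n. q ^ Suc n) sums (q / (1 - q))"
      by simp
    have "cmod (?F z - 1) \<le> q / (1 - q)"
      using term_le[OF z] by (intro norm_sums_le[OF tail geom])
    also have "\<dots> < 1 - exp (- 1)"
    proof -
      let ?t = "exp (- 1) :: real"
      \<comment> \<open>In terms of \<open>t = 1/e\<close> the claim \<open>1 / (e - 1) \<le> 1 - 1/e\<close> becomes \<open>t \<le> (1 - t)\<^sup>2\<close>,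
        true for \<open>t\<close> up to the smaller root \<open>(3 - sqrt 5) / 2 = 0.3819...\<close> of \<open>t = (1 - t)\<^sup>2\<close>;
        the rational bound \<open>10/27 = 0.3703...\<close> on \<open>t\<close> is enough.\<close>
      have "(27 / 10 :: real) < exp 1"
        using e_approx_32 by (simp add: abs_if split: if_split_asm)
      then have t: "?t < 10 / 27"
        by (simp add: exp_minus field_simps)
      have "(1 - ?t) * (1 - ?t) > (17 / 27) * (17 / 27)"
        using t by (intro mult_strict_mono) auto
      then have "(1 - ?t) * (1 - ?t) > ?t"
        using t by simp
      moreover have "(1 - ?t) * (1 - q) \<ge> (1 - ?t) * (1 - ?t)"
        using \<open>q < ?t\<close> t by (intro mult_left_mono) auto
      ultimately have "q < (1 - ?t) * (1 - q)"
        using \<open>q < ?t\<close> by linarith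
      then show ?thesis
        using \<open>q < 1\<close> by (simp add: pos_divide_less_eq)
    qed
    finally show ?thesis .
  qed
qed

text \<open>The quotients \<open>a (n + 1) / a n\<close> decrease, so they stay below the first one.\<close>

lemma log_concave_le_power:
  fixes a :: "nat \<Rightarrow> real"
  assumes pos: "\<And>n. a n > 0" and "a 0 = 1"
    and log_concave: "\<And>n. a n * a (Suc (Suc n)) \<le> a (Suc n) ^ 2"
  shows "a n \<le> a 1 ^ n"
proof (induction n)
  case 0
  then show ?case using \<open>a 0 = 1\<close> by simp
next
  case (Suc n)
  have ratio: "a (Suc k) \<le> a 1 * a k" for k
  proof (induction k)
    case 0
    then show ?case using \<open>a 0 = 1\<close> by simp
  next
    case (Suc k)
    have "a k * a (Suc (Suc k)) \<le> a (Suc k) * a (Suc k)"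
      using log_concave[of k] by (simp add: power2_eq_square)
    also have "\<dots> \<le> (a 1 * a k) * a (Suc k)"
      using Suc pos[of "Suc k"] by (intro mult_right_mono) auto
    also have "\<dots> = a k * (a 1 * a (Suc k))"
      by simp
    finally show ?case
      using pos[of k] by simp
  qed
  have "a (Suc n) \<le> a 1 * a n"
    by (rule ratio)
  also have "\<dots> \<le> a 1 * a 1 ^ n"
    using Suc pos[of 1] by (intro mult_left_mono) auto
  finally show ?case by simp
qed

text \<open>This is log-convexity at a midpoint, freed from the logarithm.\<close>

lemma Gamma_midpoint_square_le:
  fixes x h :: real
  assumes "x > 0" and "h > 0"
  shows "Gamma (x + h) ^ 2 \<le> Gamma x * Gamma (x + 2 * h)"
proof -
  have pos: "Gamma x > 0" "Gamma (x + h) > 0" "Gamma (x + 2 * h) > 0"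
    using assms by (auto intro!: Gamma_real_pos)
  have mid: "(1 - 1 / 2) *\<^sub>R x + (1 / 2) *\<^sub>R (x + 2 * h) = x + h"
    by (simp add: field_simps)
  have "ln (Gamma (x + h)) \<le> (1 - 1 / 2) * ln (Gamma x) + 1 / 2 * ln (Gamma (x + 2 * h))"
    using convex_onD[OF log_convex_Gamma_real, of "1 / 2" x "x + 2 * h"] assms
    unfolding mid by simp
  then have "ln (Gamma (x + h) ^ 2) \<le> ln (Gamma x * Gamma (x + 2 * h))"
    using pos by (simp add: ln_realpow ln_mult)
  then show ?thesis
    using pos by simp
qed

theorem theorem1:
  fixes \<alpha> \<beta> \<gamma> :: real
  assumes "\<alpha> > 0" and "\<beta> > 0" and "\<gamma> > 0"
    and "\<alpha> * \<gamma> \<ge> 1"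
    and "\<alpha>\<^sup>2 * \<gamma> \<ge> \<beta>"
    and "Gamma \<beta> powr \<gamma> = 1"
    and "ln 2 - \<alpha> * \<gamma> * ln (\<alpha> + \<beta>) + \<alpha> * \<gamma> * euler_mascheroni < 0"
    and "Gamma (\<alpha> + \<beta>) powr \<gamma> > exp 1"
  shows "subordinate (le_roy_mittag_leffler \<alpha> \<beta> \<gamma>) exp"
proof -
  define a where "a n = 1 / Gamma (\<alpha> * real n + \<beta>) powr \<gamma>" for n
  have Gamma_pos: "Gamma (\<alpha> * real n + \<beta>) > 0" for n
    using assms(1,2) by (intro Gamma_real_pos add_nonneg_pos) auto
  have a_pos: "a n > 0" for n
    using Gamma_pos[of n] by (simp add: a_def)
  have a_0: "a 0 = 1"
    using assms(6) by (simp add: a_def)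
  have "1 / (Gamma (\<alpha> + \<beta>) powr \<gamma>) < 1 / exp 1"
    using assms(8) less_trans[OF exp_gt_zero assms(8)]
    by (intro divide_strict_left_mono mult_pos_pos) auto
  then have a_1: "a 1 < exp (- 1)"
    by (simp add: a_def exp_minus inverse_eq_divide)
  have "a n * a (Suc (Suc n)) \<le> a (Suc n) ^ 2" for n
  proof -
    let ?G = "\<lambda>n. Gamma (\<alpha> * real n + \<beta>)"
    have "?G (Suc n) ^ 2 \<le> ?G n * ?G (Suc (Suc n))"
      using Gamma_midpoint_square_le[of "\<alpha> * real n + \<beta>" \<alpha>] assms(1,2)
      by (simp add: algebra_simps add_pos_nonneg)
    then have "(?G (Suc n) ^ 2) powr \<gamma> \<le> (?G n * ?G (Suc (Suc n))) powr \<gamma>"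
      using assms(3) by (intro powr_mono2) auto
    then have "(?G (Suc n) powr \<gamma>) ^ 2 \<le> ?G n powr \<gamma> * ?G (Suc (Suc n)) powr \<gamma>"
      using Gamma_pos by (simp add: powr_mult power2_eq_square less_imp_le del: of_nat_Suc)
    then have "1 / (?G n powr \<gamma> * ?G (Suc (Suc n)) powr \<gamma>) \<le> 1 / (?G (Suc n) powr \<gamma>) ^ 2"
      using Gamma_pos[of "Suc n"] by (intro divide_left_mono) (auto intro!: mult_pos_pos)
    then show ?thesis
      by (simp add: a_def power_divide)
  qed
  then have "a n \<le> a 1 ^ n" for n
    using a_pos a_0 by (intro log_concave_le_power)
  then have "subordinate (\<lambda>z. \<Sum>n. of_real (a n) * z ^ n) exp"
    using a_pos a_0 a_1 by (intro power_series_subordinate_exp[of _ "a 1"]) (auto simp: less_imp_le)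
  moreover have "le_roy_mittag_leffler \<alpha> \<beta> \<gamma> = (\<lambda>z. \<Sum>n. of_real (a n) * z ^ n)"
    by (simp add: le_roy_mittag_leffler_def a_def fun_eq_iff)
  ultimately show ?thesis
    by simp
qed

end
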